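(* Let $F(x,y,q)=\sum_{P\in\mathcal F}x^{\mathrm{xper}(P)}y^{\mathrm{yper}(P)}q^{\mathrm{area}(P)}$ be the generating function of all (nonempty) Fibonacci polyominoes counted by horizontal semiperimeter, vertical semiperimeter and area, regarded as a formal power series. Then \[ F(x,y,q) = \frac{ \displaystyle\sum_{\ell\geq 0} \frac{(xy)^{\ell+1}q^{(\ell+1)^2}(y-1)^\ell} {1-yq^{\ell+1}} \prod_{i=0}^{\ell-1} \frac{1}{(1-yq^{i+1})(1-q^{i+1})} }{ 1- \displaystyle\sum_{\ell\geq 0} \frac{(xy)^{\ell+1}q^{(\ell+1)(\ell+2)}(y-1)^\ell} {1-q^{\ell+1}} \prod_{i=0}^{\ell-1} \frac{1}{(1-yq^{i+1})(1-q^{i+1})} }, \] where an empty product equals $1$.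
   Context: A Fibonacci polyomino is a (nonempty) polyomino, considered up to translation, that is column-convex (each column is a contiguous segment of unit cells) and such that, reading columns from left to right, the bottom cell of each column lies exactly one unit above the bottom cell of the preceding column. Equivalently, it is given by a sequence of column heights $(h_1,\dots,h_m)$, $m\ge 1$, with $h_i\ge 2$ for $1\le i\le m-1$ and $h_m\ge 1$; column $i$ consists of the cells in column position $i$ and rows $i,i+1,\dots,i+h_i-1$. $\mathcal F$ is the set of all Fibonacci polyominoes. The area $\mathrm{area}(P)$ is the number of cells. The horizontal semiperimeter $\mathrm{xper}(P)$ is half the number of horizontal unit edges on the boundary of $P$, and the vertical semiperimeter $\mathrm{yper}(P)$ is half the number of vertical unit edges on the boundary of $P$ (a boundary edge is a unit edge belonging to exactly one cell of $P$). *)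

theory Defs
  imports
    "HOL-Analysis.Infinite_Sum"
    "HOL-Computational_Algebra.Formal_Power_Series"
begin

text \<open>
  The cell \<open>(i, j)\<close> is the unit square \<open>[i, i + 1] \<times> [j, j + 1]\<close>.  A horizontal unit edge is named
  by its left endpoint, a vertical one by its lower endpoint.
\<close>

type_synonym cell = "int \<times> int"

fun hedges :: "cell \<Rightarrow> (int \<times> int) set" where
  "hedges (i, j) = {(i, j), (i, j + 1)}"

fun vedges :: "cell \<Rightarrow> (int \<times> int) set" where
  "vedges (i, j) = {(i, j), (i + 1, j)}"

definition adjacent :: "cell rel" where
  "adjacent = {(c, d). c \<noteq> d \<and> (hedges c \<inter> hedges d \<noteq> {} \<or> vedges c \<inter> vedges d \<noteq> {})}"

definition polyomino :: "cell set \<Rightarrow> bool" where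
  "polyomino P \<longleftrightarrow> finite P \<and> P \<noteq> {} \<and> (\<forall>c\<in>P. \<forall>d\<in>P. (c, d) \<in> (adjacent \<inter> P \<times> P)\<^sup>*)"

definition column :: "cell set \<Rightarrow> int \<Rightarrow> int set" where
  "column P i = {j. (i, j) \<in> P}"

definition column_convex :: "cell set \<Rightarrow> bool" where
  "column_convex P \<longleftrightarrow> (\<forall>i. \<forall>j\<in>column P i. \<forall>k\<in>column P i. {j..k} \<subseteq> column P i)"

definition fibonacci_polyomino :: "cell set \<Rightarrow> bool" where
  "fibonacci_polyomino P \<longleftrightarrow> polyomino P \<and> column_convex P \<and>
     (\<forall>i. column P i \<noteq> {} \<and> column P (i + 1) \<noteq> {} \<longrightarrow>
        Min (column P (i + 1)) = Min (column P i) + 1)"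

definition translation_rel :: "cell set rel" where
  "translation_rel = {(P, Q). \<exists>a b. Q = (\<lambda>(i, j). (i + a, j + b)) ` P}"

definition fibonacci_polyominoes :: "cell set set set" where
  "fibonacci_polyominoes = {P. fibonacci_polyomino P} // translation_rel"

definition hboundary :: "cell set \<Rightarrow> (int \<times> int) set" where
  "hboundary P = {e. \<exists>!c. c \<in> P \<and> e \<in> hedges c}"

definition vboundary :: "cell set \<Rightarrow> (int \<times> int) set" where
  "vboundary P = {e. \<exists>!c. c \<in> P \<and> e \<in> vedges c}"

text \<open>
  The statistics of a translation class are the common value on its members.  Both boundary counts
  are even, since every row and every column is entered as often as it is left; hence \<open>div 2\<close> is
  exact.
\<close>

definition area :: "cell set set \<Rightarrow> nat" where
  "area C = the_elem (card ` C)"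

definition xper :: "cell set set \<Rightarrow> nat" where
  "xper C = the_elem ((\<lambda>P. card (hboundary P) div 2) ` C)"

definition yper :: "cell set set \<Rightarrow> nat" where
  "yper C = the_elem ((\<lambda>P. card (vboundary P) div 2) ` C)"

text \<open>
  Formal power series in \<open>x, y, q\<close> as \<open>\<rat>[[x]][[y]][[q]]\<close>.  With \<open>q\<close> as the outermost variable, the
  library topology on this type is the \<open>q\<close>-adic one; all infinite sums below converge in it because
  each power of \<open>q\<close> occurs in only finitely many summands.  All denominators have constant
  coefficient \<open>1\<close> in \<open>q\<close>, so the library division is multiplication by the inverse series.
\<close>

type_synonym series = "rat fps fps fps"

definition var_x :: series where "var_x = fps_const (fps_const fps_X)"

definition var_y :: series where "var_y = fps_const fps_X"

definition var_q :: series where "var_q = fps_X"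

definition fibonacci_gf :: series where
  "fibonacci_gf =
     (\<Sum>\<^sub>\<infinity>P\<in>fibonacci_polyominoes. var_x ^ xper P * var_y ^ yper P * var_q ^ area P)"

lemma summable_var_q:
  fixes f :: "nat \<Rightarrow> series"
  assumes "\<And>l. l \<le> k l"
  shows "summable (\<lambda>l. var_q ^ k l * f l)"
proof -
  let ?g = "\<lambda>l. var_q ^ k l * f l"
  have zero: "fps_nth (?g l) n = 0" if "n < l" for l n
    using that assms[of l] by (simp add: var_q_def fps_X_power_mult_nth)
  have "?g sums Abs_fps (\<lambda>n. \<Sum>l\<le>n. fps_nth (?g l) n)"
    unfolding sums_def
  proof (rule tendsto_fpsI)
    fix n
    show "\<forall>\<^sub>F N in sequentially. fps_nth (\<Sum>l<N. ?g l) n =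
            fps_nth (Abs_fps (\<lambda>n. \<Sum>l\<le>n. fps_nth (?g l) n)) n"
      using eventually_gt_at_top[of n]
    proof eventually_elim
      case (elim N)
      have "(\<Sum>l<N. fps_nth (?g l) n) = (\<Sum>l\<le>n. fps_nth (?g l) n)"
        by (rule sum.mono_neutral_right) (use elim zero in auto)
      then show ?case by (simp add: fps_sum_nth)
    qed
  qed
  then show ?thesis by (rule sums_summable)
qed

lemma divide_series_const_1:
  fixes f g :: series
  assumes "fps_nth g 0 = 1"
  shows "f / g = f * inverse g" and "g * inverse g = 1"
proof -
  show "f / g = f * inverse g" using assms by (simp add: fps_divide_unit)
  have "inverse (1 :: rat fps fps) = 1" by (rule fps_inverse_one') simp
  then show "g * inverse g = 1" using assms fps_right_inverse[of g 1] by (simp add: fps_inverse_def)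
qed

lemma summable_numerator:
  "summable (\<lambda>l. (var_x * var_y) ^ (l + 1) * var_q ^ ((l + 1)\<^sup>2) * (var_y - 1) ^ l
     / (1 - var_y * var_q ^ (l + 1)) *
     (\<Prod>i<l. 1 / ((1 - var_y * var_q ^ (i + 1)) * (1 - var_q ^ (i + 1)))))"
proof -
  have "l \<le> (l + 1)\<^sup>2" for l :: nat by (simp add: power2_eq_square)
  from summable_var_q[OF this, of "\<lambda>l. (var_x * var_y) ^ (l + 1) * (var_y - 1) ^ l
     * inverse (1 - var_y * var_q ^ (l + 1)) *
     (\<Prod>i<l. 1 / ((1 - var_y * var_q ^ (i + 1)) * (1 - var_q ^ (i + 1))))"]
  show ?thesis
    by (subst divide_series_const_1) (simp_all add: var_q_def mult_ac)
qed

lemma summable_denominator: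
  "summable (\<lambda>l. (var_x * var_y) ^ (l + 1) * var_q ^ ((l + 1) * (l + 2)) * (var_y - 1) ^ l
     / (1 - var_q ^ (l + 1)) *
     (\<Prod>i<l. 1 / ((1 - var_y * var_q ^ (i + 1)) * (1 - var_q ^ (i + 1)))))"
proof -
  have "l \<le> (l + 1) * (l + 2)" for l :: nat by simp
  from summable_var_q[OF this, of "\<lambda>l. (var_x * var_y) ^ (l + 1) * (var_y - 1) ^ l
     * inverse (1 - var_q ^ (l + 1)) *
     (\<Prod>i<l. 1 / ((1 - var_y * var_q ^ (i + 1)) * (1 - var_q ^ (i + 1))))"]
  show ?thesis
    by (subst divide_series_const_1) (simp_all add: var_q_def mult_ac)
qed

end

theory Submission
  imports Defs
begin

text \<open>
  A Fibonacci polyomino with column heights \<open>h\<^sub>1, \<dots>, h\<^sub>m\<close> has horizontal semiperimeter \<open>m\<close> and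
  vertical semiperimeter \<open>h\<^sub>1 + \<Sum>i. max 0 (h\<^bsub>i+1\<^esub> + 1 - h\<^sub>i)\<close>.  Let \<open>G\<^sub>k\<close> count the polyominoes with
  \<open>h\<^sub>1 = k\<close>, without the factor \<open>y ^ k\<close>, and let \<open>H(u) = \<Sum>k. u ^ k G\<^sub>k\<close>, so that \<open>F = H(y)\<close>.  Removing the
  first column and summing over its height gives, with \<open>v = u q\<close>, the kernel-type equation
  \<open>(1 - v) (y - v) H(u) = x v (y - v) + x v\<^sup>2 (1 - v) F + x v\<^sup>2 (y - 1) H(v)\<close>.
  Iterating it from \<open>u = y\<close> along \<open>u = y q ^ j\<close> yields a linear equation \<open>F = N + D F\<close>, whose
  coefficients are the two series of the theorem.
\<close>

section \<open>Sums of divisible families of power series\<close>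

text \<open>
  When \<open>X ^ l\<close> divides \<open>f l\<close> for all \<open>l\<close>, this is the sum of \<open>f\<close> in the \<open>X\<close>-adic topology;
  otherwise it is a junk value, obtained by cutting off the sum of the \<open>n\<close>-th coefficients after \<open>n\<close>.
\<close>

definition qsum :: "(nat \<Rightarrow> 'a::comm_ring_1 fps) \<Rightarrow> 'a fps" where
  "qsum f = Abs_fps (\<lambda>n. \<Sum>l\<le>n. fps_nth (f l) n)"

lemma nth_eq_0_of_X_power_dvd:
  fixes f :: "'a::comm_ring_1 fps"
  assumes "fps_X ^ k dvd f" "n < k"
  shows "fps_nth f n = 0"
  using assms by (auto simp: fps_X_power_mult_nth elim!: dvdE)

text \<open>Divisibility makes the terms of index above \<open>n\<close> vanish at coefficient
  \<open>n\<close>, so the cutoff may be raised: all coefficients up to \<open>N\<close> come from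
  one common partial sum.\<close>

lemma qsum_nth:
  assumes "\<And>l. fps_X ^ l dvd f l" "n \<le> N"
  shows "fps_nth (qsum f) n = fps_nth (\<Sum>l\<le>N. f l) n"
proof -
  have "(\<Sum>l\<le>N. fps_nth (f l) n) = (\<Sum>l\<le>n. fps_nth (f l) n)"
    by (rule sum.mono_neutral_right)
      (use assms nth_eq_0_of_X_power_dvd[OF assms(1)] in auto)
  then show ?thesis by (simp add: qsum_def fps_sum_nth)
qed

lemma sums_qsum:
  assumes "\<And>l. fps_X ^ l dvd f l"
  shows "f sums qsum f"
  unfolding sums_def
proof (rule tendsto_fpsI)
  fix n
  show "\<forall>\<^sub>F N in sequentially. fps_nth (\<Sum>l<N. f l) n = fps_nth (qsum f) n"
    using eventually_gt_at_top[of n]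
  proof eventually_elim
    case (elim N)
    then have "{..<N} = {..N - 1}" by auto
    with elim show ?case using qsum_nth[OF assms, of n "N - 1"] by simp
  qed
qed

text \<open>Coefficient \<open>n\<close> of a product involves only coefficients up to
  \<open>n\<close> of each factor, and for \<open>qsum f\<close> these all come from the partial sum
  up to \<open>n\<close>.\<close>

lemma qsum_mult:
  assumes "\<And>l. fps_X ^ l dvd f l"
  shows "c * qsum f = qsum (\<lambda>l. c * f l)"
proof (rule fps_ext)
  fix n
  have "fps_nth (c * qsum f) n = fps_nth (c * (\<Sum>l\<le>n. f l)) n"
    unfolding fps_mult_nth by (rule sum.cong) (auto simp: qsum_nth[OF assms, of _ n])
  also have "\<dots> = fps_nth (qsum (\<lambda>l. c * f l)) n"
    by (subst qsum_nth[of _ n n]) (auto simp: sum_distrib_left assms)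
  finally show "fps_nth (c * qsum f) n = fps_nth (qsum (\<lambda>l. c * f l)) n" .
qed

lemma qsum_add: "qsum (\<lambda>l. f l + g l) = qsum f + qsum g"
  by (rule fps_ext) (simp add: qsum_def sum.distrib)

text \<open>At coefficient \<open>n\<close> both sides are the same finite sum over the square of
  index pairs bounded by \<open>n\<close>.\<close>

lemma qsum_swap: "qsum (\<lambda>k. qsum (\<lambda>l. f k l)) = qsum (\<lambda>l. qsum (\<lambda>k. f k l))"
  unfolding qsum_def fps_nth_Abs_fps by (subst sum.swap) (rule refl)

lemma qsum_Suc:
  assumes "\<And>l. fps_X ^ l dvd f l"
  shows "qsum f = f 0 + qsum (\<lambda>l. f (Suc l))"
proof (rule fps_ext)
  fix n
  have "fps_X ^ l dvd f (Suc l)" for l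
    using assms[of "Suc l"] by (rule dvd_trans[rotated]) (simp add: le_imp_power_dvd)
  then show "fps_nth (qsum f) n = fps_nth (f 0 + qsum (\<lambda>l. f (Suc l))) n"
    using qsum_nth[OF assms, of n "Suc n"] qsum_nth[of "\<lambda>l. f (Suc l)" n n]
    by (simp del: sum.atMost_Suc add: sum.atMost_Suc_shift)
qed

text \<open>Coefficient \<open>n\<close> of a finite partial sum becomes constant once the index set
  contains the whole fibre of \<open>d\<close> over \<open>n\<close>, which is finite.\<close>

lemma infsum_fps_monomials:
  fixes c :: "'b \<Rightarrow> 'a::comm_ring_1"
  assumes "\<And>n. finite {a \<in> A. d a = n}"
  shows "(\<Sum>\<^sub>\<infinity>a\<in>A. fps_const (c a) * fps_X ^ d a) = Abs_fps (\<lambda>n. \<Sum>a | a \<in> A \<and> d a = n. c a)"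
proof (rule infsumI, unfold has_sum_def, rule tendsto_fpsI)
  fix n
  let ?S = "{a \<in> A. d a = n}"
  have "fps_nth (\<Sum>a\<in>F. fps_const (c a) * fps_X ^ d a) n = (\<Sum>a\<in>?S. c a)"
    if "finite F" "?S \<subseteq> F" "F \<subseteq> A" for F
  proof -
    have "fps_nth (\<Sum>a\<in>F. fps_const (c a) * fps_X ^ d a) n = (\<Sum>a\<in>F. if d a = n then c a else 0)"
      by (auto simp: fps_sum_nth intro!: sum.cong)
    also have "\<dots> = (\<Sum>a\<in>{a \<in> F. d a = n}. c a)"
      using that by (simp add: sum.inter_filter)
    also have "{a \<in> F. d a = n} = ?S" using that by auto
    finally show ?thesis .
  qed
  then show "\<forall>\<^sub>F F in finite_subsets_at_top A. fps_nth (\<Sum>a\<in>F. fps_const (c a) * fps_X ^ d a) n =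
      fps_nth (Abs_fps (\<lambda>n. \<Sum>a\<in>{a \<in> A. d a = n}. c a)) n"
    unfolding eventually_finite_subsets_at_top using assms[of n] by (intro exI[of _ ?S]) auto
qed

section \<open>Column heights and their generating functions\<close>

text \<open>The next column starts one row higher, so a column with a successor can share a row with
  it only if its height is at least 2.\<close>

definition fib_heights :: "nat list \<Rightarrow> bool" where
  "fib_heights hs \<longleftrightarrow> hs \<noteq> [] \<and>
     (\<forall>i<length hs. (if Suc i < length hs then 2 else 1) \<le> hs ! i)"

lemma fib_heights_Nil: "\<not> fib_heights []"
  by (simp add: fib_heights_def)

lemma fib_heights_not_Nil: "fib_heights hs \<Longrightarrow> hs \<noteq> []"
  by (simp add: fib_heights_def)

lemma fib_heights_Cons:
  "fib_heights (h # hs) \<longleftrightarrow> (if hs = [] then 1 \<le> h else 2 \<le> h \<and> fib_heights hs)"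
  by (cases hs) (auto simp: fib_heights_def All_less_Suc2)

text \<open>The truncated subtraction is intended: it is the positive part of the rise between the top cells.\<close>

fun ascent :: "nat list \<Rightarrow> nat" where
  "ascent (h # k # hs) = (k + 1 - h) + ascent (k # hs)"
| "ascent _ = 0"

lemma ascent_Cons: "hs \<noteq> [] \<Longrightarrow> ascent (h # hs) = (hd hs + 1 - h) + ascent hs"
  by (cases hs) auto

lemma fib_heights_length_le: "fib_heights hs \<Longrightarrow> length hs \<le> sum_list hs"
  by (induction hs) (auto simp: fib_heights_Nil fib_heights_Cons split: if_splits)

text \<open>Positive heights bound the length by the sum, and each height is at most the
  sum.\<close>

lemma finite_fib_heights: "finite {hs. fib_heights hs \<and> sum_list hs = n}"
  by (rule finite_subset[OF _ finite_lists_length_le[of "{..n}" n]])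
    (auto dest: fib_heights_length_le intro: member_le_sum_list)

definition fib_heights_from :: "nat \<Rightarrow> nat \<Rightarrow> nat list set" where
  "fib_heights_from k n = {hs. fib_heights hs \<and> hd hs = k \<and> sum_list hs = n}"

lemma finite_fib_heights_from: "finite (fib_heights_from k n)"
  unfolding fib_heights_from_def
  by (rule finite_subset[OF _ finite_fib_heights[of n]]) auto

lemma fib_heights_from_empty: "n < k \<Longrightarrow> fib_heights_from k n = {}"
  by (auto simp: fib_heights_from_def fib_heights_def neq_Nil_conv)

text \<open>Removal of the first column. A head is at most the sum of its list, so the second height
  \<open>b\<close> can be cut off at \<open>n - k\<close>, exactly where \<open>qsum\<close> cuts at
  coefficient \<open>n - k\<close>.\<close>

lemma fib_heights_from_rec:
  assumes "k \<le> n"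
  shows "fib_heights_from k n = (if n = k \<and> 1 \<le> k then {[k]} else {}) \<union>
    (if 2 \<le> k then Cons k ` (\<Union>b\<le>n - k. fib_heights_from b (n - k)) else {})" (is "?L = ?R")
proof (rule set_eqI)
  fix hs
  show "hs \<in> ?L \<longleftrightarrow> hs \<in> ?R"
  proof (cases hs)
    case Nil
    then show ?thesis by (auto simp: fib_heights_from_def fib_heights_Nil)
  next
    case (Cons h hs')
    have *: "fib_heights hs' \<Longrightarrow> hd hs' \<le> sum_list hs'"
      by (cases hs') (auto simp: fib_heights_Nil)
    show ?thesis
      using assms unfolding Cons
      by (auto simp: fib_heights_from_def fib_heights_Cons fib_heights_Nil image_iff dest: *)
  qed
qed

text \<open>The value lies in Q[[x]][[y]]: here \<open>fps_const fps_X\<close> is x and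
  \<open>fps_X\<close> is y.\<close>

definition heights_weight :: "nat list \<Rightarrow> rat fps fps" where
  "heights_weight hs = fps_const fps_X ^ length hs * fps_X ^ ascent hs"

text \<open>The factor \<open>y ^ k\<close> contributed by the left side of the first column is left out.\<close>

definition heights_gf :: "nat \<Rightarrow> series" where
  "heights_gf k = Abs_fps (\<lambda>n. \<Sum>hs\<in>fib_heights_from k n. heights_weight hs)"

text \<open>A first column of height \<open>k\<close> alone has area \<open>k\<close>. This makes
  families indexed by the first height summable in q.\<close>

lemma X_power_dvd_heights_gf: "fps_X ^ k dvd heights_gf k"
proof -
  have "heights_gf k = fps_X ^ k * fps_shift k (heights_gf k)"
    by (rule fps_ext) (simp add: fps_X_power_mult_nth heights_gf_def fib_heights_from_empty)
  then show ?thesis by (rule dvdI)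
qed

text \<open>The first column contributes x and \<open>k\<close> factors q; its border with a second
  column of height \<open>b\<close> contributes one y per unit of the rise \<open>b + 1 - k\<close>,
  truncated at 0.\<close>

lemma heights_gf_rec:
  "heights_gf k = var_x * var_q ^ k * ((if 1 \<le> k then 1 else 0) +
     (if 2 \<le> k then qsum (\<lambda>b. var_y ^ (b + 1 - k) * heights_gf b) else 0))" (is "_ = ?R")
proof (rule fps_ext)
  fix n
  let ?x = "fps_const fps_X :: rat fps fps" and ?y = "fps_X :: rat fps fps"
  let ?I = "(if 1 \<le> k then 1 else 0) +
     (if 2 \<le> k then qsum (\<lambda>b. var_y ^ (b + 1 - k) * heights_gf b) else 0)"
  have R: "fps_nth ?R n = (if n < k then 0 else ?x * fps_nth ?I (n - k))"
    unfolding var_x_def var_q_def by (simp only: mult.assoc fps_mult_left_const_nth fps_X_power_mult_nth) simp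
  show "fps_nth (heights_gf k) n = fps_nth ?R n"
  proof (cases "n < k")
    case True
    then show ?thesis by (simp only: R) (simp add: heights_gf_def fib_heights_from_empty)
  next
    case False
    let ?U = "\<Union>b\<le>n - k. fib_heights_from b (n - k)"
    have "(\<Sum>hs\<in>Cons k ` ?U. heights_weight hs) = (\<Sum>hs\<in>?U. heights_weight (k # hs))"
      by (subst sum.reindex) auto
    also have "\<dots> = (\<Sum>b\<le>n - k. \<Sum>hs\<in>fib_heights_from b (n - k). heights_weight (k # hs))"
      by (rule sum.UNION_disjoint) (auto simp: finite_fib_heights_from, auto simp: fib_heights_from_def)
    also have "\<dots> = (\<Sum>b\<le>n - k. \<Sum>hs\<in>fib_heights_from b (n - k). ?x * (?y ^ (b + 1 - k) * heights_weight hs))"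
      by (intro sum.cong refl)
        (auto simp: fib_heights_from_def heights_weight_def ascent_Cons power_add mult_ac
            simp del: fps_const_mult fps_const_power dest: fib_heights_not_Nil)
    also have "\<dots> = ?x * fps_nth (qsum (\<lambda>b. var_y ^ (b + 1 - k) * heights_gf b)) (n - k)"
      unfolding qsum_def var_y_def
      by (simp add: heights_gf_def sum_distrib_left)
    finally have C: "(\<Sum>hs\<in>Cons k ` ?U. heights_weight hs) =
      ?x * fps_nth (qsum (\<lambda>b. var_y ^ (b + 1 - k) * heights_gf b)) (n - k)" .
    have "fps_nth (heights_gf k) n =
        (\<Sum>hs\<in>(if n = k \<and> 1 \<le> k then {[k]} else {}) . heights_weight hs) +
        (\<Sum>hs\<in>(if 2 \<le> k then Cons k ` ?U else {}). heights_weight hs)"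
      using False unfolding heights_gf_def fps_nth_Abs_fps
      by (subst fib_heights_from_rec, simp, subst sum.union_disjoint)
        (auto simp: finite_fib_heights_from, auto simp: fib_heights_from_def fib_heights_Nil)
    then show ?thesis
      unfolding R using False C by (auto simp: heights_weight_def distrib_left)
  qed
qed

section \<open>The functional equation and its iteration\<close>

text \<open>The value \<open>H(y q ^ j)\<close> of \<open>H(u) = \<Sum>k. u ^ k G\<^sub>k\<close>, where \<open>G\<^sub>k\<close> is \<^const>\<open>heights_gf\<close>.\<close>

definition heights_gf_at :: "nat \<Rightarrow> series" where
  "heights_gf_at j = qsum (\<lambda>k. (var_y * var_q ^ j) ^ k * heights_gf k)"

text \<open>With v = uq, this is what a fixed second height \<open>b\<close> contributes, up to the
  factor x, when the recursion for \<open>heights_gf k\<close> is multiplied by u^k and summed over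
  \<open>k\<close>.\<close>

definition transfer_sum :: "series \<Rightarrow> nat \<Rightarrow> series" where
  "transfer_sum v b = qsum (\<lambda>k. if 2 \<le> k then v ^ k * var_y ^ (b + 1 - k) else 0)"

context
  fixes v :: series
  assumes X_dvd_v: "fps_X dvd v"
begin

lemma X_power_dvd_v_power: "fps_X ^ k dvd v ^ k * c"
  using X_dvd_v by (simp add: dvd_power_same)

lemma geometric_qsum: "(1 - v) * qsum (\<lambda>k. v ^ k) = 1"
proof -
  have d: "fps_X ^ k dvd v ^ k" for k
    using X_power_dvd_v_power[of k 1] by simp
  have "qsum (\<lambda>k. v ^ k) = 1 + v * qsum (\<lambda>k. v ^ k)"
    by (subst qsum_Suc) (simp_all add: d qsum_mult)
  then show ?thesis by (simp add: algebra_simps)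
qed

text \<open>For \<open>b = 0\<close> the exponent of y truncates to 0 for every \<open>k\<close>
  from 2 on, which leaves the tail of a geometric series.\<close>

lemma transfer_sum_0: "(1 - v) * transfer_sum v 0 = v\<^sup>2"
proof -
  have d: "fps_X ^ k dvd v ^ k" for k
    using X_power_dvd_v_power[of k 1] by simp
  have "transfer_sum v 0 = qsum (\<lambda>k. v\<^sup>2 * v ^ k)"
    unfolding transfer_sum_def
    by (subst qsum_Suc, (simp add: d; fail), subst qsum_Suc)
       (auto simp: d power2_eq_square mult.assoc intro: dvd_mult)
  also have "\<dots> = v\<^sup>2 * qsum (\<lambda>k. v ^ k)" by (simp add: qsum_mult d)
  finally show ?thesis
    using geometric_qsum by (simp add: mult_ac)
qed

text \<open>Raising \<open>b\<close> and \<open>k\<close> together keeps \<open>b + 1 - k\<close>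
  fixed and costs one factor \<open>v\<close>. Only the term \<open>k = 2\<close> has no
  predecessor; it gives \<open>var_y ^ b\<close> times the square of \<open>v\<close>.\<close>

lemma transfer_sum_Suc: "transfer_sum v (Suc b) = var_y ^ b * v\<^sup>2 + v * transfer_sum v b"
proof -
  have d: "fps_X ^ k dvd (if 2 \<le> k then v ^ k * c else 0)" for k c
    using X_power_dvd_v_power[of k c] by simp
  let ?g = "\<lambda>k. if k = 1 then v\<^sup>2 * var_y ^ b else 0"
  have "transfer_sum v (Suc b) =
      qsum (\<lambda>k. ?g k + v * (if 2 \<le> k then v ^ k * var_y ^ (b + 1 - k) else 0))"
    unfolding transfer_sum_def
    by (subst qsum_Suc, rule d) (auto intro!: arg_cong[of _ _ qsum] simp: fun_eq_iff power2_eq_square)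
  also have "\<dots> = qsum ?g + v * transfer_sum v b"
    unfolding transfer_sum_def qsum_add by (simp add: qsum_mult d)
  also have "qsum ?g = var_y ^ b * v\<^sup>2"
  proof (rule fps_ext)
    fix n
    \<comment> \<open>At coefficient 0 the cutoff in \<open>qsum\<close> drops index 1, so the term
      sitting there must have no constant coefficient.\<close>
    have "fps_nth (v\<^sup>2 * var_y ^ b) 0 = 0"
      using nth_eq_0_of_X_power_dvd[OF X_power_dvd_v_power[of 2 "var_y ^ b"], of 0] by simp
    then show "fps_nth (qsum ?g) n = fps_nth (var_y ^ b * v\<^sup>2) n"
      by (cases n) (auto simp: qsum_def if_distrib[of "\<lambda>f. fps_nth f _"] mult.commute cong: if_cong)
  qed
  finally show ?thesis .
qed

text \<open>The recursion in \<open>b\<close> is linear with solutions built from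
  \<open>var_y ^ b\<close> and \<open>v ^ b\<close>. Denominators stay cleared because
  \<open>var_y - v\<close> has constant coefficient y in q and so is not a unit.\<close>

lemma transfer_sum_closed_form:
  "(1 - v) * (var_y - v) * transfer_sum v b = v\<^sup>2 * (1 - v) * var_y ^ b + v\<^sup>2 * (var_y - 1) * v ^ b"
proof (induction b)
  case 0
  have "(1 - v) * (var_y - v) * transfer_sum v 0 = (var_y - v) * ((1 - v) * transfer_sum v 0)"
    by (simp add: mult_ac)
  then show ?case unfolding transfer_sum_0 by (simp add: algebra_simps)
next
  case (Suc b)
  have "(1 - v) * (var_y - v) * transfer_sum v (Suc b) =
      (1 - v) * (var_y - v) * var_y ^ b * v\<^sup>2 + v * ((1 - v) * (var_y - v) * transfer_sum v b)"
    unfolding transfer_sum_Suc by (simp only: algebra_simps)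
  also have "\<dots> = v\<^sup>2 * (1 - v) * var_y ^ Suc b + v\<^sup>2 * (var_y - 1) * v ^ Suc b"
    unfolding Suc.IH by (simp add: algebra_simps)
  finally show ?case .
qed

end

text \<open>After the sums over first and second height are exchanged, each second height
  \<open>b\<close> carries one \<open>transfer_sum v b\<close>. In its closed form the
  \<open>var_y ^ b\<close> part resums to \<open>heights_gf_at 0\<close>, and the
  \<open>v ^ b\<close> part to the next evaluation point
  \<open>heights_gf_at (Suc j)\<close>.\<close>

lemma heights_gf_at_functional_eq:
  fixes j
  defines "v \<equiv> var_y * var_q ^ Suc j"
  shows "(1 - v) * (var_y - v) * heights_gf_at j = var_x * v * (var_y - v) +
    var_x * v\<^sup>2 * (1 - v) * heights_gf_at 0 + var_x * v\<^sup>2 * (var_y - 1) * heights_gf_at (Suc j)"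
proof -
  have X_dvd_v: "fps_X dvd v" by (simp add: v_def var_q_def)
  note d = X_power_dvd_v_power[OF X_dvd_v]
  have dv: "fps_X ^ k dvd v ^ k" for k using d[of k 1] by simp
  have dG: "fps_X ^ k dvd c * heights_gf k" for k c
    by (rule dvd_mult[OF X_power_dvd_heights_gf])
  let ?t = "\<lambda>k b. if 2 \<le> k then v ^ k * var_y ^ (b + 1 - k) else 0"
  have dt: "fps_X ^ k dvd ?t k b" for k b using d by simp
  have step: "(var_y * var_q ^ j) ^ k * heights_gf k =
      var_x * (if 1 \<le> k then v ^ k else 0) + var_x * qsum (\<lambda>b. heights_gf b * ?t k b)" for k
  proof -
    have v: "(var_y * var_q ^ j) ^ k * (var_x * var_q ^ k * c) = var_x * (v ^ k * c)" for c
      by (simp add: v_def power_mult_distrib mult_ac)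
    have "v ^ k * qsum (\<lambda>b. var_y ^ (b + 1 - k) * heights_gf b) = qsum (\<lambda>b. heights_gf b * ?t k b)" if "2 \<le> k"
      by (subst qsum_mult[OF dG]) (use that in \<open>simp add: mult_ac\<close>)
    moreover have "qsum (\<lambda>b. heights_gf b * 0) = 0"
      by (rule fps_ext) (simp add: qsum_def)
    ultimately show ?thesis
      by (subst heights_gf_rec, subst v) (simp add: distrib_left)
  qed
  have "heights_gf_at j = qsum (\<lambda>k. var_x * (if 1 \<le> k then v ^ k else 0)) +
      qsum (\<lambda>k. var_x * qsum (\<lambda>b. heights_gf b * ?t k b))"
    unfolding heights_gf_at_def step qsum_add ..
  also have "qsum (\<lambda>k. var_x * (if 1 \<le> k then v ^ k else 0)) = var_x * (v * qsum (\<lambda>k. v ^ k))"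
    by (subst qsum_Suc) (simp_all add: dv qsum_mult)
  also have "qsum (\<lambda>k. var_x * qsum (\<lambda>b. heights_gf b * ?t k b)) =
      qsum (\<lambda>k. qsum (\<lambda>b. var_x * (heights_gf b * ?t k b)))"
    by (subst qsum_mult) (simp_all add: X_power_dvd_heights_gf)
  also have "\<dots> = qsum (\<lambda>b. qsum (\<lambda>k. var_x * (heights_gf b * ?t k b)))"
    by (rule qsum_swap)
  also have "\<dots> = qsum (\<lambda>b. var_x * heights_gf b * transfer_sum v b)"
    unfolding transfer_sum_def by (subst qsum_mult[OF dt]) (simp add: mult_ac)
  finally have H: "heights_gf_at j = var_x * (v * qsum (\<lambda>k. v ^ k)) +
      qsum (\<lambda>b. var_x * heights_gf b * transfer_sum v b)" .
  have dT: "fps_X ^ b dvd var_x * heights_gf b * transfer_sum v b" for b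
    by (intro dvd_mult2 dG)
  have "(1 - v) * (var_y - v) * heights_gf_at j =
      var_x * v * (var_y - v) * ((1 - v) * qsum (\<lambda>k. v ^ k)) +
      qsum (\<lambda>b. (1 - v) * (var_y - v) * (var_x * heights_gf b * transfer_sum v b))"
    unfolding H distrib_left qsum_mult[OF dT] by (simp only: mult_ac)
  also have "(\<lambda>b. (1 - v) * (var_y - v) * (var_x * heights_gf b * transfer_sum v b)) =
      (\<lambda>b. (var_x * v\<^sup>2 * (1 - v)) * (var_y ^ b * heights_gf b) +
           (var_x * v\<^sup>2 * (var_y - 1)) * (v ^ b * heights_gf b))"
  proof
    fix b
    have "(1 - v) * (var_y - v) * (var_x * heights_gf b * transfer_sum v b) =
       var_x * heights_gf b * ((1 - v) * (var_y - v) * transfer_sum v b)" by (simp only: mult_ac)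
    also have "\<dots> = (var_x * v\<^sup>2 * (1 - v)) * (var_y ^ b * heights_gf b) +
           (var_x * v\<^sup>2 * (var_y - 1)) * (v ^ b * heights_gf b)"
      unfolding transfer_sum_closed_form[OF X_dvd_v] by (simp only: distrib_left mult_ac)
    finally show "(1 - v) * (var_y - v) * (var_x * heights_gf b * transfer_sum v b) =
      (var_x * v\<^sup>2 * (1 - v)) * (var_y ^ b * heights_gf b) +
           (var_x * v\<^sup>2 * (var_y - 1)) * (v ^ b * heights_gf b)" .
  qed
  also have "qsum \<dots> = var_x * v\<^sup>2 * (1 - v) * heights_gf_at 0 + var_x * v\<^sup>2 * (var_y - 1) * heights_gf_at (Suc j)"
    unfolding qsum_add heights_gf_at_def
    by (subst (1 2) qsum_mult) (simp_all add: dG v_def)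
  finally show ?thesis
    unfolding geometric_qsum[OF X_dvd_v] by simp
qed

lemma var_y_nonzero: "var_y \<noteq> 0"
  by (simp add: var_y_def)

lemma one_minus_nth_0:
  "fps_nth (1 - var_y * var_q ^ Suc j) 0 = 1" "fps_nth (1 - var_q ^ Suc j) 0 = 1"
  by (simp_all add: var_q_def)

text \<open>In the functional equation \<open>var_y - v\<close> equals \<open>var_y * c\<close>, and
  every term on the right is also a multiple of \<open>var_y\<close>. Once that factor is cancelled,
  only the units \<open>a\<close> and \<open>c\<close> remain to be inverted.\<close>

lemma heights_gf_at_step:
  fixes j
  defines "a \<equiv> 1 - var_y * var_q ^ Suc j" and "c \<equiv> 1 - var_q ^ Suc j"
  shows "heights_gf_at j =
    var_x * var_y * var_q ^ Suc j / a + var_x * var_y * var_q ^ (2 * Suc j) / c * heights_gf_at 0 +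
    var_x * var_y * var_q ^ (2 * Suc j) * (var_y - 1) * (1 / (a * c)) * heights_gf_at (Suc j)"
proof -
  let ?Q = "var_q ^ Suc j"
  have a0: "fps_nth a 0 = 1" and c0: "fps_nth c 0 = 1"
    unfolding a_def c_def by (rule one_minus_nth_0)+
  then have ac0: "fps_nth (a * c) 0 = 1" by simp
  have a: "a * inverse a = 1" and c: "c * inverse c = 1" and ac: "(a * c) * inverse (a * c) = 1"
    using divide_series_const_1(2) a0 c0 ac0 by blast+
  \<comment> \<open>Uniqueness of the inverse of \<open>a * c\<close>: two factors equal to 1 are
    inserted and regrouped.\<close>
  have "inverse (a * c) = (a * inverse a) * (c * inverse c) * inverse (a * c)"
    by (simp add: a c)
  also have "\<dots> = ((a * c) * inverse (a * c)) * (inverse a * inverse c)"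
    by (simp only: mult_ac)
  finally have inv_ac: "inverse (a * c) = inverse a * inverse c" by (simp only: ac mult_1)
  have yc: "var_y - var_y * ?Q = var_y * c" by (simp add: c_def algebra_simps)
  have "var_y * (a * c * heights_gf_at j) = var_y * (var_x * var_y * ?Q * c +
      var_x * var_y * ?Q\<^sup>2 * a * heights_gf_at 0 +
      var_x * var_y * ?Q\<^sup>2 * (var_y - 1) * heights_gf_at (Suc j))"
    using heights_gf_at_functional_eq[of j] unfolding yc a_def[symmetric]
    by (simp only: power_mult_distrib distrib_left power2_eq_square mult_ac)
  then have E: "a * c * heights_gf_at j = var_x * var_y * ?Q * c +
      var_x * var_y * ?Q\<^sup>2 * a * heights_gf_at 0 +
      var_x * var_y * ?Q\<^sup>2 * (var_y - 1) * heights_gf_at (Suc j)"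
    using var_y_nonzero by (simp only: mult_cancel_left) simp
  have "(a * inverse a) * (c * inverse c) * heights_gf_at j =
      (a * c * heights_gf_at j) * (inverse a * inverse c)"
    by (simp only: mult_ac)
  also have "\<dots> =
      var_x * var_y * ?Q * inverse a * (c * inverse c) +
      var_x * var_y * ?Q\<^sup>2 * inverse c * (a * inverse a) * heights_gf_at 0 +
      var_x * var_y * ?Q\<^sup>2 * (var_y - 1) * (inverse a * inverse c) * heights_gf_at (Suc j)"
    unfolding E by (simp only: distrib_left distrib_right mult_ac)
  finally show ?thesis
    unfolding a c divide_series_const_1(1)[OF a0] divide_series_const_1(1)[OF c0]
      divide_series_const_1(1)[OF ac0] inv_ac power_even_eq by (simp add: mult.assoc)
qed

text \<open>The product of the coefficients of \<open>heights_gf_at (Suc i)\<close> in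
  \<open>heights_gf_at_step\<close> for \<open>i < l\<close>; the exponent of q is 2 (1 + ... + l) =
  l (l + 1).\<close>

definition iteration_coeff :: "nat \<Rightarrow> series" where
  "iteration_coeff l = (var_x * var_y) ^ l * var_q ^ (l * (l + 1)) * (var_y - 1) ^ l *
     (\<Prod>i<l. 1 / ((1 - var_y * var_q ^ (i + 1)) * (1 - var_q ^ (i + 1))))"

text \<open>Each induction step expands the remainder, the last summand, by
  \<open>heights_gf_at_step\<close>.\<close>

lemma heights_gf_at_0_iterate:
  "heights_gf_at 0 =
     (\<Sum>l<L. iteration_coeff l * (var_x * var_y * var_q ^ Suc l / (1 - var_y * var_q ^ Suc l) +
        var_x * var_y * var_q ^ (2 * Suc l) / (1 - var_q ^ Suc l) * heights_gf_at 0)) +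
     iteration_coeff L * heights_gf_at L"
proof (induction L)
  case 0
  show ?case by (simp add: iteration_coeff_def)
next
  case (Suc L)
  have e: "Suc L * (Suc L + 1) = L * (L + 1) + 2 * Suc L" by simp
  have "iteration_coeff (Suc L) = iteration_coeff L * (var_x * var_y * var_q ^ (2 * Suc L) * (var_y - 1) *
      (1 / ((1 - var_y * var_q ^ Suc L) * (1 - var_q ^ Suc L))))"
    unfolding iteration_coeff_def e power_add prod.lessThan_Suc by (simp add: mult_ac)
  then have "iteration_coeff L * heights_gf_at L =
      iteration_coeff L * (var_x * var_y * var_q ^ Suc L / (1 - var_y * var_q ^ Suc L) +
        var_x * var_y * var_q ^ (2 * Suc L) / (1 - var_q ^ Suc L) * heights_gf_at 0) +
      iteration_coeff (Suc L) * heights_gf_at (Suc L)"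
    by (subst heights_gf_at_step) (simp only: distrib_left mult.assoc)
  with Suc.IH show ?case by (simp only: sum.lessThan_Suc add.assoc)
qed

lemma X_power_dvd_iteration_coeff: "fps_X ^ l dvd iteration_coeff l * c"
proof -
  have "fps_X ^ l dvd var_q ^ (l * (l + 1))"
    unfolding var_q_def by (rule le_imp_power_dvd) simp
  then show ?thesis unfolding iteration_coeff_def by (simp add: dvd_mult dvd_mult2)
qed

text \<open>The remainder of the iteration tends to 0 in the q-adic topology, which leaves F = N + F
  D with N and D the two series. As 1 - D has constant coefficient 1, the equation can be solved for
  F.\<close>

lemma heights_gf_at_0_eq:
  "heights_gf_at 0 =
    (\<Sum>l. (var_x * var_y) ^ (l + 1) * var_q ^ ((l + 1)\<^sup>2) * (var_y - 1) ^ l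
         / (1 - var_y * var_q ^ (l + 1)) *
       (\<Prod>i<l. 1 / ((1 - var_y * var_q ^ (i + 1)) * (1 - var_q ^ (i + 1))))) /
    (1 -
     (\<Sum>l. (var_x * var_y) ^ (l + 1) * var_q ^ ((l + 1) * (l + 2)) * (var_y - 1) ^ l
         / (1 - var_q ^ (l + 1)) *
       (\<Prod>i<l. 1 / ((1 - var_y * var_q ^ (i + 1)) * (1 - var_q ^ (i + 1))))))"
    (is "?F = (\<Sum>l. ?N l) / (1 - (\<Sum>l. ?D l))")
proof -
  note div = divide_series_const_1(1)[OF one_minus_nth_0(1)] divide_series_const_1(1)[OF one_minus_nth_0(2)]
  have N: "?N l = iteration_coeff l * (var_x * var_y * var_q ^ Suc l / (1 - var_y * var_q ^ Suc l))" for l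
  proof -
    have e: "(Suc l)\<^sup>2 = l * Suc l + Suc l" by (simp add: power2_eq_square)
    show ?thesis
      unfolding iteration_coeff_def Suc_eq_plus1[symmetric]
      unfolding e power_add div by (simp add: mult_ac)
  qed
  have D: "?D l = iteration_coeff l * (var_x * var_y * var_q ^ (2 * Suc l) / (1 - var_q ^ Suc l))" for l
  proof -
    have e: "Suc l * (l + 2) = l * Suc l + 2 * Suc l" by simp
    show ?thesis
      unfolding iteration_coeff_def Suc_eq_plus1[symmetric]
      unfolding e power_add div by (simp add: mult_ac)
  qed
  have dN: "fps_X ^ l dvd ?N l" and dD: "fps_X ^ l dvd ?D l" for l
    unfolding N D by (rule X_power_dvd_iteration_coeff)+
  have "?F = qsum (\<lambda>l. ?N l + ?F * ?D l)"
  proof (rule fps_ext)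
    fix n
    \<comment> \<open>With \<open>Suc n\<close> iterations the partial sum runs over all indices up
      to \<open>n\<close>, and the remainder is divisible by \<open>fps_X ^ Suc n\<close>, hence
      invisible at coefficient \<open>n\<close>.\<close>
    have "fps_nth ?F n = fps_nth ((\<Sum>l<Suc n. ?N l + ?F * ?D l) + iteration_coeff (Suc n) * heights_gf_at (Suc n)) n"
      unfolding N D by (subst heights_gf_at_0_iterate[of "Suc n"]) (simp only: distrib_left mult_ac)
    also have "\<dots> = fps_nth (\<Sum>l\<le>n. ?N l + ?F * ?D l) n"
      using nth_eq_0_of_X_power_dvd[OF X_power_dvd_iteration_coeff, of n "Suc n"]
      by (simp only: lessThan_Suc_atMost fps_add_nth) simp
    also have "\<dots> = fps_nth (qsum (\<lambda>l. ?N l + ?F * ?D l)) n"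
      by (rule qsum_nth[symmetric, OF dvd_add[OF dN dvd_mult[OF dD]] order_refl])
    finally show "fps_nth ?F n = fps_nth (qsum (\<lambda>l. ?N l + ?F * ?D l)) n" .
  qed
  also have "\<dots> = qsum ?N + ?F * qsum ?D"
    unfolding qsum_add qsum_mult[OF dD] ..
  finally have F: "?F * (1 - qsum ?D) = qsum ?N"
    by (simp add: algebra_simps)
  \<comment> \<open>At coefficient 0, \<open>qsum\<close> keeps only the term \<open>?D 0\<close>,
    which is a multiple of the square of q.\<close>
  have "fps_nth (?D 0) 0 = 0"
    unfolding D div by (simp add: var_q_def)
  then have D0: "fps_nth (1 - qsum ?D) 0 = 1"
    by (simp add: qsum_def)
  have "qsum ?N / (1 - qsum ?D) = ?F * ((1 - qsum ?D) * inverse (1 - qsum ?D))"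
    unfolding divide_series_const_1(1)[OF D0] F[symmetric] by (simp only: mult.assoc)
  also have "\<dots> = ?F" unfolding divide_series_const_1(2)[OF D0] by simp
  finally show ?thesis
    using sums_unique[OF sums_qsum[OF dN]] sums_unique[OF sums_qsum[OF dD]] by (simp only:)
qed

text \<open>Evaluation at u = y restores the factor \<open>var_y ^ hd hs\<close> left out of
  \<open>heights_gf\<close>. The coefficients of each power of q are compared by grouping the
  finitely many lists by head.\<close>

lemma heights_gf_at_0_infsum:
  "heights_gf_at 0 = (\<Sum>\<^sub>\<infinity>hs | fib_heights hs.
     var_x ^ length hs * var_y ^ (hd hs + ascent hs) * var_q ^ sum_list hs)"
proof -
  let ?c = "\<lambda>hs. fps_X ^ hd hs * heights_weight hs"
  have "(\<Sum>\<^sub>\<infinity>hs | fib_heights hs. var_x ^ length hs * var_y ^ (hd hs + ascent hs) * var_q ^ sum_list hs) =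
      (\<Sum>\<^sub>\<infinity>hs | fib_heights hs. fps_const (?c hs) * fps_X ^ sum_list hs)"
    by (simp add: var_x_def var_y_def var_q_def heights_weight_def power_add mult_ac)
  also have "\<dots> = Abs_fps (\<lambda>n. \<Sum>hs | fib_heights hs \<and> sum_list hs = n. ?c hs)"
    by (subst infsum_fps_monomials) (simp_all add: finite_fib_heights)
  also have "\<dots> = heights_gf_at 0"
  proof (rule fps_ext)
    fix n
    have hd: "hd hs \<le> sum_list hs" if "fib_heights hs" for hs
      using that by (cases hs) (auto simp: fib_heights_Nil)
    have "{hs. fib_heights hs \<and> sum_list hs = n} = (\<Union>k\<le>n. fib_heights_from k n)"
      by (auto simp: fib_heights_from_def dest: hd)
    then have "(\<Sum>hs | fib_heights hs \<and> sum_list hs = n. ?c hs) = (\<Sum>k\<le>n. \<Sum>hs\<in>fib_heights_from k n. ?c hs)"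
      by (simp only:) (rule sum.UNION_disjoint, auto simp: finite_fib_heights_from, auto simp: fib_heights_from_def)
    also have "\<dots> = (\<Sum>k\<le>n. fps_X ^ k * (\<Sum>hs\<in>fib_heights_from k n. heights_weight hs))"
      unfolding sum_distrib_left by (intro sum.cong refl) (simp add: fib_heights_from_def)
    finally show "fps_nth (Abs_fps (\<lambda>n. \<Sum>hs | fib_heights hs \<and> sum_list hs = n. ?c hs)) n =
        fps_nth (heights_gf_at 0) n"
      by (simp add: heights_gf_at_def qsum_def heights_gf_def var_y_def)
  qed
  finally show ?thesis by simp
qed

section \<open>Polyominoes and column heights\<close>

definition heights_poly :: "nat list \<Rightarrow> cell set" where
  "heights_poly hs = {(i, j). 0 \<le> i \<and> i < int (length hs) \<and> i \<le> j \<and> j < i + int (hs ! nat i)}"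

lemma column_heights_poly:
  "column (heights_poly hs) i =
     (if 0 \<le> i \<and> i < int (length hs) then {i..<i + int (hs ! nat i)} else {})"
  by (auto simp: column_def heights_poly_def)

text \<open>Serves for cells and, since edges are also named by integer pairs, for both sets of
  boundary edges.\<close>

lemma card_eq_sum_columns:
  assumes "\<And>n. finite (column S (int n))" "\<And>i. i \<notin> int ` {..<m} \<Longrightarrow> column S i = {}"
  shows "finite S" "card S = (\<Sum>n<m. card (column S (int n)))"
proof -
  have S: "S = Sigma (int ` {..<m}) (column S)"
    using assms(2) by (auto simp: column_def)
  show "finite S" by (subst S) (use assms(1) in auto)
  show "card S = (\<Sum>n<m. card (column S (int n)))"
    by (subst S, subst card_SigmaI) (use assms(1) in \<open>auto simp: sum.reindex\<close>)
qed

lemma not_in_int_image: "i \<notin> int ` {..<m} \<Longrightarrow> \<not> (0 \<le> i \<and> i < int m)"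
  by (metis imageI lessThan_iff nat_0_le nat_less_iff)

lemma finite_heights_poly: "finite (heights_poly hs)"
  and card_heights_poly: "card (heights_poly hs) = sum_list hs"
proof -
  have 1: "finite (column (heights_poly hs) (int n))" for n
    by (simp add: column_heights_poly)
  have 2: "column (heights_poly hs) i = {}" if "i \<notin> int ` {..<length hs}" for i
    using not_in_int_image[OF that] by (auto simp: column_heights_poly)
  show "finite (heights_poly hs)" by (rule card_eq_sum_columns(1)[OF 1 2])
  show "card (heights_poly hs) = sum_list hs"
    by (subst card_eq_sum_columns(2)[OF 1 2])
      (auto simp: column_heights_poly sum_list_sum_nth atLeast0LessThan)
qed

section \<open>Boundary edges and semiperimeters\<close>

lemma ex1_two_candidates:
  assumes "d \<noteq> e"
  shows "(\<exists>!c. c \<in> P \<and> (c = d \<or> c = e)) \<longleftrightarrow> (d \<in> P) \<noteq> (e \<in> P)"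
  using assms by (cases "d \<in> P"; cases "e \<in> P") blast+

text \<open>A horizontal edge lies on exactly two cells, the one above and the one below, so lying
  on exactly one cell of \<open>P\<close> is an exclusive or.\<close>

lemma hboundary_iff: "(i, j) \<in> hboundary P \<longleftrightarrow> ((i, j) \<in> P) \<noteq> ((i, j - 1) \<in> P)"
proof -
  have "(i, j) \<in> hedges c \<longleftrightarrow> c = (i, j) \<or> c = (i, j - 1)" for c
    by (cases c) auto
  then show ?thesis
    unfolding hboundary_def mem_Collect_eq using ex1_two_candidates[of "(i, j)" "(i, j - 1)" P] by simp
qed

lemma vboundary_iff: "(i, j) \<in> vboundary P \<longleftrightarrow> ((i, j) \<in> P) \<noteq> ((i - 1, j) \<in> P)"
proof -
  have "(i, j) \<in> vedges c \<longleftrightarrow> c = (i, j) \<or> c = (i - 1, j)" for c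
    by (cases c) auto
  then show ?thesis
    unfolding vboundary_def mem_Collect_eq using ex1_two_candidates[of "(i, j)" "(i - 1, j)" P] by simp
qed

lemma fib_heights_nth_ge_2:
  assumes "fib_heights hs" "Suc i < length hs"
  shows "2 \<le> hs ! i"
proof -
  have "(if Suc i < length hs then 2 else 1) \<le> hs ! i"
    using assms unfolding fib_heights_def by (blast intro: Suc_lessD)
  with assms(2) show ?thesis by simp
qed

lemma fib_heights_nth_pos:
  assumes "fib_heights hs" "i < length hs"
  shows "1 \<le> hs ! i"
proof -
  have "(if Suc i < length hs then 2 else 1) \<le> hs ! i"
    using assms unfolding fib_heights_def by blast
  then show ?thesis by (cases "Suc i < length hs") simp_all
qed

text \<open>Each column has exactly two horizontal boundary edges, below its bottom cell and above
  its top cell.\<close>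

lemma card_hboundary_heights_poly:
  assumes "fib_heights hs"
  shows "card (hboundary (heights_poly hs)) = 2 * length hs"
proof -
  let ?H = "hboundary (heights_poly hs)"
  have col: "column ?H (int n) = {int n, int n + int (hs ! n)}" if "n < length hs" for n
    using that fib_heights_nth_pos[OF assms that] by (auto simp: column_def hboundary_iff heights_poly_def)
  have out: "column ?H i = {}" if "i \<notin> int ` {..<length hs}" for i
    using not_in_int_image[OF that] by (auto simp: column_def hboundary_iff heights_poly_def)
  have fin: "finite (column ?H (int n))" for n
  proof (cases "n < length hs")
    case True
    then show ?thesis by (simp add: col)
  next
    case False
    then show ?thesis by (subst out) auto
  qed
  have "card (column ?H (int n)) = 2" if "n < length hs" for n
    using fib_heights_nth_pos[OF assms that] by (simp add: col[OF that])
  then show ?thesis by (subst card_eq_sum_columns(2)[OF fin out]) auto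
qed

text \<open>For the heights of a Fibonacci polyomino this says that rows are entered as often as
  they are left: the left side counts all vertical boundary edges, the right side twice those where
  a row is entered from the left.\<close>

lemma sum_vertical_steps:
  assumes "hs \<noteq> []"
  shows "hd hs + (\<Sum>n<length hs. if Suc n < length hs
      then 1 + (hs ! n - (hs ! Suc n + 1)) + (hs ! Suc n + 1 - hs ! n) else hs ! n) =
    2 * (hd hs + ascent hs)"
  using assms
proof (induction hs rule: ascent.induct)
  case (1 h k hs)
  let ?f = "\<lambda>hs n. if Suc n < length hs
      then 1 + (hs ! n - (hs ! Suc n + 1)) + (hs ! Suc n + 1 - hs ! n) else hs ! n"
  have len: "length (h # k # hs) = Suc (length (k # hs))" by simp
  have arith: "h + A = 2 * (h + (k + 1 - h + c))"
    if "A = 1 + (h - (k + 1)) + (k + 1 - h) + S" "k + S = 2 * (k + c)" for A S c :: nat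
    using that by arith
  have "(\<Sum>n<length (h # k # hs). ?f (h # k # hs) n) =
      ?f (h # k # hs) 0 + (\<Sum>n<length (k # hs). ?f (k # hs) n)"
    by (simp only: len sum.lessThan_Suc_shift nth_Cons_Suc Suc_less_eq)
  also have "?f (h # k # hs) 0 = 1 + (h - (k + 1)) + (k + 1 - h)" by simp
  finally show ?case
    unfolding list.sel ascent.simps
    by (rule arith) (use 1 in \<open>simp only: list.sel list.distinct not_False_eq_True\<close>)
qed auto

lemma card_vboundary_heights_poly:
  assumes "fib_heights hs"
  shows "card (vboundary (heights_poly hs)) = 2 * (hd hs + ascent hs)"
proof -
  let ?V = "vboundary (heights_poly hs)" and ?m = "length hs"
  have ne: "hs \<noteq> []" using assms by (rule fib_heights_not_Nil)
  have col0: "column ?V 0 = {0..<int (hd hs)}"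
    using ne by (auto simp: column_def vboundary_iff heights_poly_def hd_conv_nth)
  \<comment> \<open>Between neighbouring columns the bottom cell of the left one is exposed, and so
    are the rows between the two tops; of the two intervals at least one is empty.\<close>
  have col: "column ?V (int (Suc n)) = (if Suc n < ?m then
      insert (int n) ({int n + int (hs ! n)..<int n + 1 + int (hs ! Suc n)} \<union>
        {int n + 1 + int (hs ! Suc n)..<int n + int (hs ! n)})
      else {int n..<int n + int (hs ! n)})" if "n < ?m" for n
    using that fib_heights_nth_pos[OF assms, of n] fib_heights_nth_ge_2[OF assms, of n]
    by (auto simp: column_def vboundary_iff heights_poly_def nat_add_distrib)
  \<comment> \<open>There is one more vertical grid line than there are columns, hence
    \<open>Suc ?m\<close>.\<close>
  have out: "column ?V i = {}" if "i \<notin> int ` {..<Suc ?m}" for i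
    using not_in_int_image[OF that] by (auto simp: column_def vboundary_iff heights_poly_def)
  have fin: "finite (column ?V (int n))" for n
  proof (cases n)
    case (Suc k)
    show ?thesis
    proof (cases "k < ?m")
      case True
      then show ?thesis unfolding Suc by (subst col) auto
    next
      case False
      with Suc show ?thesis by (subst out) auto
    qed
  qed (simp add: col0)
  have card_col: "card (column ?V (int (Suc n))) = (if Suc n < ?m
      then 1 + (hs ! n - (hs ! Suc n + 1)) + (hs ! Suc n + 1 - hs ! n) else hs ! n)" if "n < ?m" for n
  proof (cases "Suc n < ?m")
    case True
    then have "2 \<le> hs ! n" by (rule fib_heights_nth_ge_2[OF assms])
    then show ?thesis
      unfolding col[OF that] using True
      by (subst if_P, simp, subst card_insert_disjoint, simp, simp, subst card_Un_disjoint) auto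
  next
    case False
    then show ?thesis unfolding col[OF that] by simp
  qed
  have "card ?V = hd hs + (\<Sum>n<?m. if Suc n < ?m
      then 1 + (hs ! n - (hs ! Suc n + 1)) + (hs ! Suc n + 1 - hs ! n) else hs ! n)"
    by (subst card_eq_sum_columns(2)[OF fin out], assumption)
      (simp add: sum.lessThan_Suc_shift col0 card_col del: sum.lessThan_Suc of_nat_Suc)
  then show ?thesis using sum_vertical_steps[OF ne] by simp
qed

section \<open>Translations and the statistics of translation classes\<close>

definition translate :: "int \<Rightarrow> int \<Rightarrow> cell set \<Rightarrow> cell set" where
  "translate a b P = (\<lambda>(i, j). (i + a, j + b)) ` P"

lemma translate_iff: "(i, j) \<in> translate a b P \<longleftrightarrow> (i - a, j - b) \<in> P"
  by (force simp: translate_def)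

lemma translation_rel_iff: "(P, Q) \<in> translation_rel \<longleftrightarrow> (\<exists>a b. Q = translate a b P)"
  by (simp add: translation_rel_def translate_def)

lemma translate_translate: "translate c d (translate a b P) = translate (a + c) (b + d) P"
  by (auto simp: translate_iff algebra_simps)

lemma translate_0: "translate 0 0 P = P"
  by (simp add: translate_def)

lemma equiv_translation_rel: "equiv UNIV translation_rel"
proof (rule equivI)
  show "refl translation_rel"
    by (rule refl_onI) (metis translate_0 translation_rel_iff)
  show "sym translation_rel"
  proof (rule symI)
    fix P Q assume "(P, Q) \<in> translation_rel"
    then obtain a b where "Q = translate a b P" by (auto simp: translation_rel_iff)
    then have "P = translate (- a) (- b) Q" by (simp add: translate_translate translate_0)
    then show "(Q, P) \<in> translation_rel" by (auto simp: translation_rel_iff)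
  qed
  show "trans translation_rel"
    by (rule transI) (metis translation_rel_iff translate_translate)
qed simp_all

lemma card_translate: "card (translate a b P) = card P"
  unfolding translate_def by (rule card_image) (auto simp: inj_on_def)

lemma hboundary_translate: "hboundary (translate a b P) = translate a b (hboundary P)"
  by (auto simp: translate_iff hboundary_iff algebra_simps)

lemma vboundary_translate: "vboundary (translate a b P) = translate a b (vboundary P)"
  by (auto simp: translate_iff vboundary_iff algebra_simps)

text \<open>A translation-invariant statistic has a one-element image on a class, so
  \<open>the_elem\<close> can be computed on any representative.\<close>

lemma the_elem_translation_class:
  assumes "\<And>a b. f (translate a b P) = f P"
  shows "the_elem (f ` (translation_rel `` {P})) = f P"
proof -
  have "P \<in> translation_rel `` {P}"
    using equiv_class_self[OF equiv_translation_rel] by simp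
  then have "f P \<in> f ` (translation_rel `` {P})" by (rule imageI)
  moreover have "f ` (translation_rel `` {P}) \<subseteq> {f P}"
    using assms by (auto simp: translation_rel_iff)
  ultimately have "f ` (translation_rel `` {P}) = {f P}" by blast
  then show ?thesis by simp
qed

abbreviation heights_class :: "nat list \<Rightarrow> cell set set" where
  "heights_class hs \<equiv> translation_rel `` {heights_poly hs}"

lemma area_heights_class: "area (heights_class hs) = sum_list hs"
  unfolding area_def by (subst the_elem_translation_class) (simp_all add: card_translate card_heights_poly)

lemma xper_heights_class: "fib_heights hs \<Longrightarrow> xper (heights_class hs) = length hs"
  unfolding xper_def
  by (subst the_elem_translation_class)
    (simp_all add: card_translate hboundary_translate card_hboundary_heights_poly)

lemma yper_heights_class: "fib_heights hs \<Longrightarrow> yper (heights_class hs) = hd hs + ascent hs"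
  unfolding yper_def
  by (subst the_elem_translation_class)
    (simp_all add: card_translate vboundary_translate card_vboundary_heights_poly)

text \<open>A translation carries columns to columns. Comparing the ranges of nonempty columns
  forces the horizontal shift to be 0 and the lengths to agree; the cardinalities of the columns
  then give the heights.\<close>

lemma heights_class_inj:
  assumes "fib_heights hs" "fib_heights hs'" "heights_class hs = heights_class hs'"
  shows "hs = hs'"
proof -
  have "(heights_poly hs, heights_poly hs') \<in> translation_rel"
    using eq_equiv_class[OF assms(3) equiv_translation_rel] by simp
  then obtain a b where t: "heights_poly hs' = translate a b (heights_poly hs)"
    by (auto simp: translation_rel_iff)
  have col: "column (heights_poly hs') i = (+) b ` column (heights_poly hs) (i - a)" for i
  proof (rule set_eqI)
    fix j
    have "j \<in> column (heights_poly hs') i \<longleftrightarrow> j - b \<in> column (heights_poly hs) (i - a)"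
      unfolding t by (simp add: column_def translate_iff)
    also have "\<dots> \<longleftrightarrow> j \<in> (+) b ` column (heights_poly hs) (i - a)"
      by (auto simp: image_iff intro!: bexI[of _ "j - b"])
    finally show "j \<in> column (heights_poly hs') i \<longleftrightarrow> j \<in> (+) b ` column (heights_poly hs) (i - a)" .
  qed
  have ne: "column (heights_poly ks) i \<noteq> {} \<longleftrightarrow> i \<in> {0..<int (length ks)}" if "fib_heights ks" for ks i
    using fib_heights_nth_pos[OF that, of "nat i"] by (auto simp: column_heights_poly nat_less_iff)
  have dom: "{0..<int (length hs')} = {a..<a + int (length hs)}"
  proof (rule set_eqI)
    fix i
    show "i \<in> {0..<int (length hs')} \<longleftrightarrow> i \<in> {a..<a + int (length hs)}"
      using ne[OF assms(2), of i] ne[OF assms(1), of "i - a"] unfolding col by auto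
  qed
  have len: "length hs > 0" "length hs' > 0"
    using assms(1,2) by (auto dest: fib_heights_not_Nil)
  \<comment> \<open>The left ends of the two equal intervals lie in each other, which gives both
    inequalities between \<open>a\<close> and 0.\<close>
  have "0 \<in> {a..<a + int (length hs)}" unfolding dom[symmetric] using len by simp
  moreover have "a \<in> {0..<int (length hs')}" unfolding dom using len by simp
  ultimately have a: "a = 0" by simp
  have length: "length hs = length hs'"
    using arg_cong[OF dom, of card] by simp
  show ?thesis
  proof (rule nth_equalityI[OF length])
    fix i assume "i < length hs"
    have "card (column (heights_poly hs') (int i)) = card (column (heights_poly hs) (int i - a))"
      unfolding col by (rule card_image) simp
    with \<open>i < length hs\<close> show "hs ! i = hs' ! i"
      by (simp add: a column_heights_poly flip: length)
  qed
qed

section \<open>Fibonacci polyominoes as translates of height diagrams\<close>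

lemma adjacent_iff:
  "((i, j), (k, l)) \<in> adjacent \<longleftrightarrow> i = k \<and> \<bar>j - l\<bar> = 1 \<or> j = l \<and> \<bar>i - k\<bar> = 1"
  by (auto simp: adjacent_def)

lemma sym_adjacent: "sym adjacent"
  by (auto simp: sym_def adjacent_def)

text \<open>For connectedness, every cell is joined to the origin: down its column to the bottom,
  then from bottom cell to bottom cell leftwards. Symmetry of adjacency joins any two cells.\<close>

lemma fibonacci_polyomino_heights_poly:
  assumes "fib_heights hs"
  shows "fibonacci_polyomino (heights_poly hs)"
proof -
  let ?P = "heights_poly hs"
  let ?R = "adjacent \<inter> ?P \<times> ?P"
  have len: "0 < length hs" using assms by (auto dest: fib_heights_not_Nil)
  have down: "((int i, int i + int j), (int i, int i)) \<in> ?R\<^sup>*" if "i < length hs" "j < hs ! i" for i j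
    using that(2)
  proof (induction j)
    case (Suc j)
    have "((int i, int i + int (Suc j)), (int i, int i + int j)) \<in> ?R"
      using Suc.prems that(1) by (simp add: adjacent_iff heights_poly_def)
    moreover have "((int i, int i + int j), (int i, int i)) \<in> ?R\<^sup>*"
      using Suc by simp
    ultimately show ?case by (rule converse_rtrancl_into_rtrancl)
  qed simp
  have bottom: "((int i, int i), (0, 0)) \<in> ?R\<^sup>*" if "i < length hs" for i
    using that
  proof (induction i)
    case (Suc i)
    then have h: "2 \<le> hs ! i" "1 \<le> hs ! Suc i" 
      using fib_heights_nth_ge_2[OF assms] fib_heights_nth_pos[OF assms] by blast+
    \<comment> \<open>The left neighbour of a bottom cell is the second cell of the preceding
      column, present because that column has height at least 2.\<close>
    have "((int (Suc i), int (Suc i)), (int i, int i + int 1)) \<in> ?R"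
      using h Suc.prems by (simp add: adjacent_iff heights_poly_def nat_add_distrib)
    moreover have "((int i, int i + int 1), (int i, int i)) \<in> ?R\<^sup>*"
      using h Suc.prems by (intro down) auto
    moreover have "((int i, int i), (0, 0)) \<in> ?R\<^sup>*" using Suc by simp
    ultimately show ?case by (rule converse_rtrancl_into_rtrancl[OF _ rtrancl_trans])
  qed simp
  have root: "(c, (0, 0)) \<in> ?R\<^sup>*" if "c \<in> ?P" for c
  proof -
    obtain i j where c: "c = (i, j)" "0 \<le> i" "i < int (length hs)" "i \<le> j" "j < i + int (hs ! nat i)"
      using \<open>c \<in> ?P\<close> by (auto simp: heights_poly_def)
    have "((int (nat i), int (nat i) + int (nat (j - i))), (int (nat i), int (nat i))) \<in> ?R\<^sup>*"
      using c by (intro down) auto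
    moreover have "((int (nat i), int (nat i)), (0, 0)) \<in> ?R\<^sup>*"
      using c by (intro bottom) auto
    ultimately have "((int (nat i), int (nat i) + int (nat (j - i))), (0, 0)) \<in> ?R\<^sup>*"
      by (rule rtrancl_trans)
    then show ?thesis using c by simp
  qed
  have "sym ?R" by (intro sym_Int sym_adjacent) (auto simp: sym_def)
  then have sym: "sym (?R\<^sup>*)" by (rule sym_rtrancl)
  have "(c, d) \<in> ?R\<^sup>*" if "c \<in> ?P" "d \<in> ?P" for c d
    by (rule rtrancl_trans[OF root[OF that(1)]]) (rule symD[OF sym root[OF that(2)]])
  moreover have "(0, 0) \<in> ?P"
    using len fib_heights_nth_pos[OF assms, of 0] by (auto simp: heights_poly_def)
  ultimately have "polyomino ?P" unfolding polyomino_def using finite_heights_poly by blast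
  moreover have "column_convex ?P"
    by (auto simp: column_convex_def column_heights_poly)
  moreover have "Min (column ?P i) = i" if "column ?P i \<noteq> {}" for i
    using that by (auto simp: column_heights_poly split: if_splits intro!: Min_eqI)
  ultimately show ?thesis by (auto simp: fibonacci_polyomino_def)
qed

text \<open>A step changes the column by at most one, so a path that passes from column
  \<open>i\<close> or further left to beyond it must step horizontally from \<open>i\<close> to
  \<open>i + 1\<close>.\<close>

lemma path_crosses_vertical_line:
  assumes "(c, d) \<in> (adjacent \<inter> P \<times> P)\<^sup>*" "fst c \<le> i" "i < fst d"
  shows "\<exists>j. (i, j) \<in> P \<and> (i + 1, j) \<in> P"
  using assms
proof (induction rule: rtrancl_induct)
  case (step d e)
  show ?case
  proof (cases "i < fst d")
    case False
    obtain k l m n where "d = (k, l)" "e = (m, n)" by (cases d, cases e) auto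
    then show ?thesis
      using step.hyps(2) step.prems False by (auto simp: adjacent_def split: if_splits)
  qed (use step in auto)
qed auto

text \<open>Connectedness leaves no gap between the extreme columns, the bottoms then rise by one
  from each column to the next, and convexity makes each column an interval. So the cardinalities of
  the columns determine \<open>P\<close> up to translation.\<close>

lemma fibonacci_polyomino_eq_translate:
  assumes "fibonacci_polyomino P"
  obtains hs a b where "fib_heights hs" "P = translate a b (heights_poly hs)"
proof -
  have fin: "finite P" and ne: "P \<noteq> {}"
    and conn: "\<And>c d. c \<in> P \<Longrightarrow> d \<in> P \<Longrightarrow> (c, d) \<in> (adjacent \<inter> P \<times> P)\<^sup>*"
    and conv: "column_convex P"
    and bot: "\<And>i. column P i \<noteq> {} \<Longrightarrow> column P (i + 1) \<noteq> {} \<Longrightarrow>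
        Min (column P (i + 1)) = Min (column P i) + 1"
    using assms by (auto simp: fibonacci_polyomino_def polyomino_def)
  define I where "I = fst ` P"
  \<comment> \<open>The pair \<open>(a, b)\<close> will be the bottom cell of the leftmost column,
    and \<open>m + 1\<close> the number of columns.\<close>
  define a where "a = Min I"
  define m where "m = nat (Max I - a)"
  define b where "b = Min (column P a)"
  have finI: "finite I" "I \<noteq> {}" using fin ne by (auto simp: I_def)
  have finc: "finite (column P i)" for i
    by (rule finite_subset[of _ "snd ` P"]) (use fin in \<open>force simp: column_def\<close>)+
  have aI: "a \<in> I" and MI: "Max I \<in> I" using finI by (simp_all add: a_def)
  have aM: "a \<le> Max I" using finI aI by simp
  have range: "a \<le> i" "i \<le> a + int m" if "column P i \<noteq> {}" for i
  proof -
    have "i \<in> I" using that by (force simp: I_def column_def)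
    then show "a \<le> i" "i \<le> a + int m" using finI aM by (auto simp: a_def m_def)
  qed
  have cross: "column P i \<inter> column P (i + 1) \<noteq> {}" if "a \<le> i" "i < a + int m" for i
  proof -
    obtain c d where "c \<in> P" "fst c = a" "d \<in> P" "fst d = Max I"
      using aI MI by (auto simp: I_def)
    then show ?thesis
      using path_crosses_vertical_line[OF conn, of c d i] that aM
      by (auto simp: column_def m_def)
  qed
  have nonempty: "column P (a + int n) \<noteq> {}" if "n \<le> m" for n
  proof (cases "n < m")
    case True
    then show ?thesis using cross[of "a + int n"] by auto
  next
    case False
    then have "a + int n = Max I" using that aM by (simp add: m_def)
    then show ?thesis using MI by (auto simp: I_def column_def)
  qed
  have Min: "Min (column P (a + int n)) = b + int n" if "n \<le> m" for n
    using that
  proof (induction n)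
    case (Suc n)
    then show ?case
      using bot[of "a + int n"] nonempty[of n] nonempty[of "Suc n"] by (simp add: add_ac)
  qed (simp add: b_def)
  have interval: "column P (a + int n) = {b + int n..<b + int n + int (card (column P (a + int n)))}"
    if "n \<le> m" for n
  proof -
    let ?C = "column P (a + int n)"
    have "?C = {Min ?C..Max ?C}"
    proof (rule equalityI)
      show "?C \<subseteq> {Min ?C..Max ?C}" using finc by auto
      show "{Min ?C..Max ?C} \<subseteq> ?C"
        using conv finc nonempty[OF that] unfolding column_convex_def by (meson Max_in Min_in)
    qed
    then have "?C = {b + int n..Max ?C}" unfolding Min[OF that] .
    then obtain M where C: "?C = {b + int n..M}" by blast
    have le: "b + int n \<le> M" using nonempty[OF that] unfolding C by simp
    have "card ?C = nat (M - (b + int n) + 1)" unfolding C by simp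
    with le have "{b + int n..M} = {b + int n..<b + int n + int (card ?C)}" by auto
    with C show ?thesis by (rule trans)
  qed
  define hs where "hs = map (\<lambda>n. card (column P (a + int n))) [0..<Suc m]"
  have len: "length hs = Suc m" by (simp add: hs_def)
  have nth: "hs ! n = card (column P (a + int n))" if "n \<le> m" for n
    using that by (simp add: hs_def del: upt_Suc)
  have "fib_heights hs"
    unfolding fib_heights_def len
  proof (intro conjI allI impI)
    fix n assume n: "n < Suc m"
    show "(if Suc n < Suc m then 2 else 1) \<le> hs ! n"
    proof (cases "n < m")
      case True
      then obtain j where j: "j \<in> column P (a + int n)" "j \<in> column P (a + int (Suc n))"
        using cross[of "a + int n"] by (auto simp: add_ac)
      \<comment> \<open>The shared row \<open>j\<close> lies no lower than the bottom of the next
        column, hence above the bottom of column \<open>n\<close>, which therefore has height at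
        least 2.\<close>
      have "b + int (Suc n) \<le> j" "j < b + int n + int (hs ! n)"
        using interval[of n] interval[of "Suc n"] j True nth[of n] by auto
      then show ?thesis using True by simp
    next
      case False
      then show ?thesis
        using n nonempty[of n] nth[of n] finc[of "a + int n"] by (simp add: Suc_le_eq card_gt_0_iff)
    qed
  qed (simp add: hs_def)
  moreover have "P = translate a b (heights_poly hs)"
  proof -
    have "(i, j) \<in> P \<longleftrightarrow> (i - a, j - b) \<in> heights_poly hs" for i j
    proof (cases "a \<le> i \<and> i \<le> a + int m")
      case True
      define n where "n = nat (i - a)"
      have n: "n \<le> m" "i = a + int n" using True by (auto simp: n_def)
      have "(i, j) \<in> P \<longleftrightarrow> j \<in> column P (a + int n)" by (simp add: column_def n)
      also have "\<dots> \<longleftrightarrow> j \<in> {b + int n..<b + int n + int (hs ! n)}"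
        using interval[OF n(1)] nth[OF n(1)] by auto
      also have "\<dots> \<longleftrightarrow> (i - a, j - b) \<in> heights_poly hs"
        using n by (auto simp: heights_poly_def len)
      finally show ?thesis .
    next
      case False
      then have "column P i = {}" using range[of i] by auto
      then show ?thesis using False by (auto simp: column_def heights_poly_def len)
    qed
    then show ?thesis by (auto simp: translate_iff)
  qed
  ultimately show ?thesis using that by blast
qed

lemma bij_betw_heights_class: "bij_betw heights_class {hs. fib_heights hs} fibonacci_polyominoes"
  unfolding bij_betw_def
proof
  show "inj_on heights_class {hs. fib_heights hs}"
    by (rule inj_onI) (auto intro: heights_class_inj)
  show "heights_class ` {hs. fib_heights hs} = fibonacci_polyominoes"
  proof
    show "heights_class ` {hs. fib_heights hs} \<subseteq> fibonacci_polyominoes"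
      using fibonacci_polyomino_heights_poly by (auto simp: fibonacci_polyominoes_def intro!: quotientI)
    show "fibonacci_polyominoes \<subseteq> heights_class ` {hs. fib_heights hs}"
    proof
      fix C assume "C \<in> fibonacci_polyominoes"
      then obtain P where P: "fibonacci_polyomino P" "C = translation_rel `` {P}"
        unfolding fibonacci_polyominoes_def by (auto elim: quotientE)
      obtain hs a b where hs: "fib_heights hs" "P = translate a b (heights_poly hs)"
        using fibonacci_polyomino_eq_translate[OF P(1)] .
      then have "heights_class hs = C"
        unfolding P(2) by (intro equiv_class_eq[OF equiv_translation_rel]) (auto simp: translation_rel_iff)
      with hs show "C \<in> heights_class ` {hs. fib_heights hs}" by auto
    qed
  qed
qed

lemma fibonacci_gf_eq: "fibonacci_gf = heights_gf_at 0"
proof -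
  have "fibonacci_gf = (\<Sum>\<^sub>\<infinity>hs | fib_heights hs. var_x ^ xper (heights_class hs) *
      var_y ^ yper (heights_class hs) * var_q ^ area (heights_class hs))"
    unfolding fibonacci_gf_def
    by (rule infsum_reindex_bij_betw[OF bij_betw_heights_class, symmetric])
  also have "\<dots> = heights_gf_at 0"
    unfolding heights_gf_at_0_infsum
    by (rule infsum_cong) (simp add: xper_heights_class yper_heights_class area_heights_class)
  finally show ?thesis .
qed

theorem theorem2p1:
  shows "fibonacci_gf =
    (\<Sum>l. (var_x * var_y) ^ (l + 1) * var_q ^ ((l + 1)\<^sup>2) * (var_y - 1) ^ l
         / (1 - var_y * var_q ^ (l + 1)) *
       (\<Prod>i<l. 1 / ((1 - var_y * var_q ^ (i + 1)) * (1 - var_q ^ (i + 1))))) /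
    (1 -
     (\<Sum>l. (var_x * var_y) ^ (l + 1) * var_q ^ ((l + 1) * (l + 2)) * (var_y - 1) ^ l
         / (1 - var_q ^ (l + 1)) *
       (\<Prod>i<l. 1 / ((1 - var_y * var_q ^ (i + 1)) * (1 - var_q ^ (i + 1))))))"
  unfolding fibonacci_gf_eq by (rule heights_gf_at_0_eq)

end
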